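(* Let $f_{\theta,\alpha}:\mathbb{R}^n\to\mathbb{R}^n$ be a Learned Proximal Network (LPN) with differentiable activation function, potential $\Psi_{\theta,\alpha}$ and implicit regularizer $\varphi_{\theta,\alpha}$. Let $\mathbf{fid}:\mathbb{R}^n\to\mathbb{R}$ be $L_{\mathbf{fid}}$-smooth (differentiable with $L_{\mathbf{fid}}$-Lipschitz gradient, $L_{\mathbf{fid}}>0$) and bounded below, let $0<\eta<1/L_{\mathbf{fid}}$, $0<\gamma\le1$, $C>0$ and $p>3/2$ be fixed, and let $x_0\in\mathbb{R}^n$. Let $\{x_k\}_{k\ge 0}$ and $\{w_{k}\}_{k\ge 1}$ be any sequences in $\mathbb{R}^n$ such that for every $k\ge0$, with $$G_k(w)\coloneqq\frac{\gamma}{2}\|w\|^2+(1-\gamma)\Psi_{\theta,\alpha}(w)-\langle x_k-\eta\nabla\mathbf{fid}(x_k),w\rangle,$$ one has $$\|\nabla G_k(w_{k+1})\|\le\frac{C}{(k+1)^p}\qquad\text{and}\qquad x_{k+1}=f_{\theta,\alpha}(w_{k+1}).$$ Define $F\coloneqq\eta\,\mathbf{fid}+\gamma\varphi_{\theta,\alpha}$. Then: (i) $F(x_k)$ converges. (ii) $\sum_{k=1}^{\infty}\|x_k-x_{k+1}\|^2<+\infty$. (iii) If $\xi:\mathbb{R}^{n+1}\to\mathbb{R}$, $\xi(x,t)\coloneqq F(x)+\frac12t^2$, is a KL function, then $\sum_{k=1}^{\infty}\|x_k-x_{k+1}\|<+\infty$ and $\{x_k\}_{k\ge1}$ converges to a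 critical point $x^*$ of $F$.
   Context: Norms and inner products are Euclidean. ICNN: An input convex neural network is a function $\psi_\theta:\mathbb{R}^n\to\mathbb{R}$, $\psi_\theta(x)\coloneqq z_K$, where $z_{i+1}\coloneqq\sigma(W_iz_i+H_ix+b_i)$ for $i=0,\dots,K-1$, with $W_0,z_0\equiv 0$; here $H_i,W_i$ are linear maps (of compatible dimensions, $z_K$ scalar), each $W_i$ has non-negative entries, $b_i$ are bias vectors, and the activation $\sigma:\mathbb{R}\to\mathbb{R}$ is convex and non-decreasing, applied element-wise. LPN: $f_{\theta,\alpha}:\mathbb{R}^n\to\mathbb{R}^n$ is an LPN with strong convexity modulus $\alpha$ if $0<\alpha<1$ and $f_{\theta,\alpha}(y)\in\partial\psi_\theta(y)+\alpha y$ for all $y$, where $\psi_\theta$ is an ICNN with Lipschitz activation $\sigma$ and $\partial$ is the convex subdifferential. Its potential is $\Psi_{\theta,\alpha}\coloneqq\psi_\theta+\frac{\alpha}{2}\|\cdot\|^2$ and its implicit regularizer is $\varphi_{\theta,\alpha}\coloneqq\Psi_{\theta,\alpha}^*-\frac12\|\cdot\|^2$, where $\Psi^*(y)\coloneqq\sup_x\{\langle x,y\rangle-\Psi(x)\}$ is the convex conjugate. When $\sigma$ is differentiable, $f_{\theta,\alpha}=\nabla\Psi_{\theta,\alpha}$. (The function $\varphi_{\theta,\alpha}$ is real-valued and continuously differentiable.) KL: A continuously differentiable $F:\mathbb{R}^d\to\mathbb{R}$ has the KL property at $x^*\in\mathbb{R}^d$ if there exist $\zeta\in(0,+\infty]$,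 a neighborhood $U$ of $x^*$, and a continuous concave function $\chi:[0,\zeta)\to[0,\infty)$ such that $\chi(0)=0$, $\chi\in C^1((0,\zeta))$, $\chi'(s)>0$ for all $s\in(0,\zeta)$, and $\chi'(F(x)-F(x^* ))\,\|\nabla F(x)\|\ge 1$ for every $x\in U$ with $F(x^* )<F(x)<F(x^* )+\zeta$. $F$ is a KL function if it has the KL property at every point of $\mathbb{R}^d$. *)

theory Defs
  imports "HOL-Analysis.Analysis"
begin

text \<open>Only meaningful where \<open>f\<close> is differentiable; the gradient is then unique.\<close>

definition gradient :: "('a::real_inner \<Rightarrow> real) \<Rightarrow> 'a \<Rightarrow> 'a" where
  "gradient f x = (THE D. GDERIV f x :> D)"

definition continuously_differentiable :: "('a::euclidean_space \<Rightarrow> real) \<Rightarrow> bool" where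
  "continuously_differentiable f \<longleftrightarrow>
     (\<forall>x. f differentiable (at x)) \<and> continuous_on UNIV (gradient f)"

definition L_smooth :: "real \<Rightarrow> ('a::euclidean_space \<Rightarrow> real) \<Rightarrow> bool" where
  "L_smooth L f \<longleftrightarrow> (\<forall>x. f differentiable (at x)) \<and> L-lipschitz_on UNIV (gradient f)"

definition critical_point :: "('a::euclidean_space \<Rightarrow> real) \<Rightarrow> 'a \<Rightarrow> bool" where
  "critical_point f x \<longleftrightarrow> GDERIV f x :> 0"

definition subdifferential :: "('a::real_inner \<Rightarrow> real) \<Rightarrow> 'a \<Rightarrow> 'a set" where
  "subdifferential f y = {g. \<forall>z. f z \<ge> f y + g \<bullet> (z - y)}"

definition convex_conjugate :: "('a::real_inner \<Rightarrow> real) \<Rightarrow> 'a \<Rightarrow> ereal" where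
  "convex_conjugate f y = (SUP x. ereal (x \<bullet> y - f x))"

text \<open>
  The parameters \<open>\<theta>\<close> of an input convex neural network. Layer \<open>i\<close> is a vector with
  \<open>icnn_width \<theta> i\<close> entries, represented as a function on \<open>nat\<close> of which only the values
  at indices below the width matter. For the map from layer \<open>i\<close> to layer \<open>i + 1\<close>,
  \<open>icnn_W \<theta> i j l\<close> is the entry of \<open>W\<^sub>i\<close> in row \<open>j\<close> and column \<open>l\<close>,
  \<open>icnn_H \<theta> i j\<close> is the row \<open>j\<close> of \<open>H\<^sub>i\<close>, and \<open>icnn_b \<theta> i j\<close> is the entry \<open>j\<close> of \<open>b\<^sub>i\<close>.
\<close>

record 'a icnn_params =
  icnn_depth :: nat
  icnn_width :: "nat \<Rightarrow> nat"
  icnn_W :: "nat \<Rightarrow> nat \<Rightarrow> nat \<Rightarrow> real"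
  icnn_H :: "nat \<Rightarrow> nat \<Rightarrow> 'a"
  icnn_b :: "nat \<Rightarrow> nat \<Rightarrow> real"

primrec icnn_layer ::
  "(real \<Rightarrow> real) \<Rightarrow> 'a::real_inner icnn_params \<Rightarrow> 'a \<Rightarrow> nat \<Rightarrow> nat \<Rightarrow> real" where
  "icnn_layer \<sigma> \<theta> x 0 = (\<lambda>j. 0)"
| "icnn_layer \<sigma> \<theta> x (Suc i) =
     (\<lambda>j. \<sigma> ((\<Sum>l<icnn_width \<theta> i. icnn_W \<theta> i j l * icnn_layer \<sigma> \<theta> x i l)
            + icnn_H \<theta> i j \<bullet> x + icnn_b \<theta> i j))"

text \<open>The output layer has width 1, so its only entry is the one at index 0.\<close>

definition icnn :: "(real \<Rightarrow> real) \<Rightarrow> 'a::real_inner icnn_params \<Rightarrow> 'a \<Rightarrow> real" where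
  "icnn \<sigma> \<theta> x = icnn_layer \<sigma> \<theta> x (icnn_depth \<theta>) 0"

definition is_icnn :: "(real \<Rightarrow> real) \<Rightarrow> 'a::real_inner icnn_params \<Rightarrow> bool" where
  "is_icnn \<sigma> \<theta> \<longleftrightarrow>
     convex_on UNIV \<sigma> \<and> mono \<sigma> \<and>
     icnn_width \<theta> (icnn_depth \<theta>) = 1 \<and>
     (\<forall>i<icnn_depth \<theta>. \<forall>j<icnn_width \<theta> (Suc i). \<forall>l<icnn_width \<theta> i. icnn_W \<theta> i j l \<ge> 0) \<and>
     (\<forall>j<icnn_width \<theta> 1. \<forall>l<icnn_width \<theta> 0. icnn_W \<theta> 0 j l = 0)"

definition is_LPN ::
  "(real \<Rightarrow> real) \<Rightarrow> 'a::real_inner icnn_params \<Rightarrow> real \<Rightarrow> ('a \<Rightarrow> 'a) \<Rightarrow> bool" where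
  "is_LPN \<sigma> \<theta> \<alpha> f \<longleftrightarrow>
     is_icnn \<sigma> \<theta> \<and> (\<exists>L. L-lipschitz_on UNIV \<sigma>) \<and> 0 < \<alpha> \<and> \<alpha> < 1 \<and>
     (\<forall>y. f y \<in> (\<lambda>g. g + \<alpha> *\<^sub>R y) ` subdifferential (icnn \<sigma> \<theta>) y)"

definition LPN_potential ::
  "(real \<Rightarrow> real) \<Rightarrow> 'a::real_inner icnn_params \<Rightarrow> real \<Rightarrow> 'a \<Rightarrow> real" where
  "LPN_potential \<sigma> \<theta> \<alpha> x = icnn \<sigma> \<theta> x + \<alpha> / 2 * (norm x)\<^sup>2"

text \<open>The conjugate is finite here, because the potential of an LPN is strongly convex.\<close>

definition LPN_regularizer ::
  "(real \<Rightarrow> real) \<Rightarrow> 'a::real_inner icnn_params \<Rightarrow> real \<Rightarrow> 'a \<Rightarrow> real" where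
  "LPN_regularizer \<sigma> \<theta> \<alpha> y =
     real_of_ereal (convex_conjugate (LPN_potential \<sigma> \<theta> \<alpha>) y) - 1 / 2 * (norm y)\<^sup>2"

text \<open>
  The desingularizing function, often written \<open>chi\<close>, is called \<open>\<omega>\<close>, and \<open>\<omega>'\<close> is its
  derivative; \<open>\<zeta> = \<infinity>\<close> is allowed.
\<close>

definition KL_property_at :: "('a::euclidean_space \<Rightarrow> real) \<Rightarrow> 'a \<Rightarrow> bool" where
  "KL_property_at F xs \<longleftrightarrow>
     continuously_differentiable F \<and>
     (\<exists>(\<zeta>::ereal) U (\<omega>::real \<Rightarrow> real) \<omega>'.
        0 < \<zeta> \<and> xs \<in> interior U \<and>
        continuous_on {s. 0 \<le> s \<and> ereal s < \<zeta>} \<omega> \<and>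
        concave_on {s. 0 \<le> s \<and> ereal s < \<zeta>} \<omega> \<and>
        (\<forall>s. 0 \<le> s \<and> ereal s < \<zeta> \<longrightarrow> 0 \<le> \<omega> s) \<and>
        \<omega> 0 = 0 \<and>
        (\<forall>s. 0 < s \<and> ereal s < \<zeta> \<longrightarrow> (\<omega> has_real_derivative \<omega>' s) (at s)) \<and>
        continuous_on {s. 0 < s \<and> ereal s < \<zeta>} \<omega>' \<and>
        (\<forall>s. 0 < s \<and> ereal s < \<zeta> \<longrightarrow> 0 < \<omega>' s) \<and>
        (\<forall>x\<in>U. F xs < F x \<and> ereal (F x) < ereal (F xs) + \<zeta> \<longrightarrow>
           \<omega>' (F x - F xs) * norm (gradient F x) \<ge> 1))"

definition KL_function :: "('a::euclidean_space \<Rightarrow> real) \<Rightarrow> bool" where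
  "KL_function F \<longleftrightarrow> (\<forall>x. KL_property_at F x)"

end

theory Submission
  imports Defs
begin

text \<open>
  If \<open>x = f w\<close> then \<open>w\<close> is a subgradient of the conjugate of the potential at \<open>x\<close>, so that
  \<open>w - x\<close> serves as the gradient of the regularizer, and the iteration is an inexact proximal
  gradient step
  \<open>x\<^sub>k\<^sub>+\<^sub>1 - x\<^sub>k = e\<^sub>k - \<eta> \<nabla>fid x\<^sub>k - \<gamma> (w\<^sub>k\<^sub>+\<^sub>1 - x\<^sub>k\<^sub>+\<^sub>1)\<close>
  whose error \<open>e\<^sub>k\<close> is the gradient of \<open>G\<^sub>k\<close> at \<open>w\<^sub>k\<^sub>+\<^sub>1\<close>. Since the regularizer is 1-weakly convex
  and \<open>\<eta> L + \<gamma> < 2\<close>, each step decreases \<open>F\<close> by a multiple of \<open>\<parallel>x\<^sub>k\<^sub>+\<^sub>1 - x\<^sub>k\<parallel>\<^sup>2\<close>, up to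
  a multiple of \<open>\<parallel>e\<^sub>k\<parallel>\<^sup>2\<close>. This error is absorbed in the second variable of \<open>\<xi>\<close>: for
  \<open>t\<^sub>k\<close> proportional to \<open>(k + 1)\<close> to the power \<open>1/2 - p\<close>, which is summable exactly when
  \<open>p > 3/2\<close>, the values \<open>\<xi>(x\<^sub>k, t\<^sub>k)\<close> decrease strictly. The regularizer is coercive, so the
  iterates are bounded, and the standard finite-length argument for descent sequences of a KL
  function applies to \<open>(x\<^sub>k, t\<^sub>k)\<close>.
\<close>

subsection \<open>Gradients and subgradients\<close>

lemma gradient_eqI:
  assumes "GDERIV f x :> D"
  shows "gradient f x = D"
  unfolding gradient_def
proof (rule the_equality)
  fix E assume "GDERIV f x :> E"
  with assms have "(\<lambda>h. h \<bullet> D) = (\<lambda>h. h \<bullet> E)"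
    unfolding gderiv_def by (rule has_derivative_unique)
  then have "(E - D) \<bullet> D = (E - D) \<bullet> E" by (rule fun_cong)
  then have "(E - D) \<bullet> (E - D) = 0" by (simp add: inner_diff_right)
  then show "E = D" by simp
qed (rule assms)

lemma GDERIV_gradient:
  fixes f :: "'a::euclidean_space \<Rightarrow> real"
  assumes "f differentiable (at x)"
  shows "GDERIV f x :> gradient f x"
proof -
  obtain f' where f': "(f has_derivative f') (at x)"
    using assms by (auto simp: differentiable_def)
  then interpret linear f' by (rule has_derivative_linear)
  have "f' = (\<lambda>h. h \<bullet> adjoint f' 1)"
    using adjoint_works[OF linear_axioms, of _ 1] by (simp add: fun_eq_iff)
  then have "GDERIV f x :> adjoint f' 1"
    using f' by (simp add: gderiv_def)
  then show ?thesis
    by (simp add: gradient_eqI)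
qed

text \<open>\<open>g\<close> is \<open>f\<close> along the segment minus its quadratic upper model.
  By Cauchy-Schwarz and the Lipschitz gradient its slope is nonpositive on [0,1], so comparing
  \<open>g 1\<close> with \<open>g 0\<close> gives the bound.\<close>

lemma L_smooth_descent:
  fixes f :: "'a::euclidean_space \<Rightarrow> real"
  assumes "L_smooth L f"
  shows "f y \<le> f x + gradient f x \<bullet> (y - x) + L / 2 * (norm (y - x))\<^sup>2"
proof -
  define d where "d = y - x"
  define g where "g = (\<lambda>t. f (x + t *\<^sub>R d) - t * (gradient f x \<bullet> d) - L / 2 * (norm d)\<^sup>2 * t\<^sup>2)"
  have der: "(g has_real_derivative
      (gradient f (x + t *\<^sub>R d) \<bullet> d - gradient f x \<bullet> d - L * (norm d)\<^sup>2 * t)) (at t)" for t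
  proof -
    have "GDERIV f (x + t *\<^sub>R d) :> gradient f (x + t *\<^sub>R d)"
      using assms by (intro GDERIV_gradient) (auto simp: L_smooth_def)
    then have f: "(f has_derivative (\<lambda>h. h \<bullet> gradient f (x + t *\<^sub>R d))) (at (x + t *\<^sub>R d))"
      by (simp add: gderiv_def)
    have l: "((\<lambda>t. x + t *\<^sub>R d) has_derivative (\<lambda>h. h *\<^sub>R d)) (at t)"
      by (auto intro!: derivative_eq_intros)
    have "((\<lambda>t. f (x + t *\<^sub>R d)) has_derivative (\<lambda>h. (h *\<^sub>R d) \<bullet> gradient f (x + t *\<^sub>R d))) (at t)"
      using has_derivative_compose[OF l f] .
    then have chain: "((\<lambda>t. f (x + t *\<^sub>R d)) has_real_derivative (gradient f (x + t *\<^sub>R d) \<bullet> d)) (at t)"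
      unfolding has_field_derivative_def
      by (rule has_derivative_eq_rhs) (simp add: fun_eq_iff inner_commute)
    have "((\<lambda>t. L / 2 * (norm d)\<^sup>2 * t\<^sup>2) has_real_derivative L * (norm d)\<^sup>2 * t) (at t)"
      and "((\<lambda>t. t * (gradient f x \<bullet> d)) has_real_derivative gradient f x \<bullet> d) (at t)"
      by (auto intro!: derivative_eq_intros)
    then show ?thesis
      unfolding g_def by (intro DERIV_diff chain)
  qed
  have "g 1 \<le> g 0"
  proof (rule DERIV_nonpos_imp_nonincreasing[where f = g])
    fix t :: real assume t: "0 \<le> t" "t \<le> 1"
    have "(gradient f (x + t *\<^sub>R d) - gradient f x) \<bullet> d
        \<le> norm (gradient f (x + t *\<^sub>R d) - gradient f x) * norm d"
      by (rule norm_cauchy_schwarz)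
    also have "\<dots> \<le> (L * norm (t *\<^sub>R d)) * norm d"
      using lipschitz_onD[of L UNIV "gradient f" "x + t *\<^sub>R d" x] assms
      by (intro mult_right_mono) (auto simp: L_smooth_def dist_norm)
    also have "\<dots> = L * (norm d)\<^sup>2 * t"
      using t by (simp add: power2_eq_square)
    finally show "\<exists>y. (g has_real_derivative y) (at t) \<and> y \<le> 0"
      using der[of t] by (auto simp: inner_diff_left)
  qed simp
  then show ?thesis
    by (simp add: g_def d_def)
qed

text \<open>Subtracting the linear function \<open>g \<bullet> y\<close> from \<open>f\<close> gives
  a function with a global minimum at \<open>x\<close>, where its derivative must vanish.\<close>

lemma subgradient_imp_GDERIV:
  fixes f :: "'a::euclidean_space \<Rightarrow> real"
  assumes "f differentiable (at x)" and "g \<in> subdifferential f x"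
  shows "GDERIV f x :> g"
proof -
  have f: "GDERIV f x :> gradient f x"
    using assms(1) by (rule GDERIV_gradient)
  have "((\<lambda>y. f y - g \<bullet> y) has_derivative (\<lambda>h. h \<bullet> gradient f x - g \<bullet> h)) (at x)"
    using f unfolding gderiv_def by (auto intro!: derivative_eq_intros)
  moreover have "f x - g \<bullet> x \<le> f y - g \<bullet> y" for y
    using assms(2) by (simp add: subdifferential_def inner_diff_right algebra_simps)
  ultimately have "(\<lambda>h. h \<bullet> gradient f x - g \<bullet> h) = (\<lambda>h. 0)"
    by (intro has_derivative_local_min always_eventually allI)
  from fun_cong[OF this, of "gradient f x - g"]
  have "(gradient f x - g) \<bullet> (gradient f x - g) = 0"
    by (simp add: inner_diff_right inner_commute)
  then have "gradient f x = g" by simp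
  with f show ?thesis by simp
qed

text \<open>The bound \<open>B\<close> excludes the value \<infinity>, at which
  \<open>real_of_ereal\<close> would return the default 0 and the inequality could fail.\<close>

lemma convex_conjugate_ge:
  assumes "\<And>u. u \<bullet> y - f u \<le> B"
  shows "u \<bullet> y - f u \<le> real_of_ereal (convex_conjugate f y)"
proof -
  have "convex_conjugate f y \<le> ereal B"
    unfolding convex_conjugate_def using assms by (intro SUP_least) simp
  moreover have "ereal (u \<bullet> y - f u) \<le> convex_conjugate f y"
    unfolding convex_conjugate_def by (rule SUP_upper) simp
  ultimately show ?thesis
    by (cases "convex_conjugate f y") auto
qed

lemma convex_conjugate_attained:
  assumes "\<And>u. u \<bullet> y - f u \<le> v \<bullet> y - f v"
  shows "convex_conjugate f y = ereal (v \<bullet> y - f v)"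
  unfolding convex_conjugate_def
  by (rule antisym) (use assms in \<open>auto intro!: SUP_least SUP_upper2[of v]\<close>)

subsection \<open>Descent sequences of KL functions\<close>

lemma power_decay_telescoping:
  assumes p: "p > 3 / 2" and B: "B > 0"
  obtains t :: "nat \<Rightarrow> real" where "\<And>k. 0 < t k" and "summable t"
    and "\<And>k. B * (1 / real (k + 1) powr p)\<^sup>2 < (t k)\<^sup>2 - (t (Suc k))\<^sup>2"
proof -
  \<comment> \<open>In \<open>A\<close>, the denominator \<open>2 * p - 1\<close> cancels the factor
    from the mean value theorem, \<open>2 powr (2 * p)\<close> pays for replacing the intermediate
    point \<open>z\<close> by the larger \<open>2 * (k + 1)\<close>, and the leading 2 makes the
    inequality strict.\<close>
  define A where "A = 2 * B * 2 powr (2 * p) / (2 * p - 1)"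
  define t where "t = (\<lambda>k. sqrt A * real (k + 1) powr (1 / 2 - p))"
  have A: "0 < A" using p B by (simp add: A_def)
  have "summable (\<lambda>k. real k powr (1 / 2 - p))"
    using p by (simp add: summable_real_powr_iff)
  then have "summable (\<lambda>k. real (k + 1) powr (1 / 2 - p))"
    using summable_iff_shift[of "\<lambda>k. real k powr (1 / 2 - p)" 1] by blast
  then have "summable t"
    unfolding t_def by (rule summable_mult)
  moreover have "0 < t k" for k using A by (simp add: t_def)
  moreover have "B * (1 / real (k + 1) powr p)\<^sup>2 < (t k)\<^sup>2 - (t (Suc k))\<^sup>2" for k
  proof -
    have sq: "(t j)\<^sup>2 = A * real (j + 1) powr (1 - 2 * p)" for j
      using A by (simp add: t_def power_mult_distrib powr_power algebra_simps)
    have "\<exists>z. real (k + 1) < z \<and> z < real (k + 2) \<and>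
        real (k + 2) powr (1 - 2 * p) - real (k + 1) powr (1 - 2 * p)
        = (real (k + 2) - real (k + 1)) * ((1 - 2 * p) * z powr (1 - 2 * p - 1))"
      by (intro MVT2) (auto intro!: derivative_eq_intros)
    then obtain z where z: "real (k + 1) < z" "z < real (k + 2)"
      "real (k + 1) powr (1 - 2 * p) - real (k + 2) powr (1 - 2 * p) = (2 * p - 1) * z powr (- 2 * p)"
      by (auto simp: algebra_simps)
    have "B * (1 / real (k + 1) powr p)\<^sup>2 = B * real (k + 1) powr (- 2 * p)"
      by (simp add: power_divide powr_power powr_minus_divide mult.commute)
    also have "\<dots> < 2 * B * real (k + 1) powr (- 2 * p)"
      using B by simp
    also have "\<dots> = A * (2 * p - 1) * (2 * real (k + 1)) powr (- 2 * p)"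
    proof -
      have "(2 * real (k + 1)) powr (- 2 * p) = 2 powr (- 2 * p) * real (k + 1) powr (- 2 * p)"
        by (rule powr_mult)
      moreover have "A * (2 * p - 1) * 2 powr (- 2 * p) = 2 * B"
        using p by (simp add: A_def powr_minus)
      ultimately show ?thesis by (simp only: mult.assoc[symmetric])
    qed
    also have "\<dots> \<le> A * (2 * p - 1) * z powr (- 2 * p)"
      using p A z by (intro mult_left_mono powr_mono2') auto
    also have "\<dots> = (t k)\<^sup>2 - (t (Suc k))\<^sup>2"
      using z(3) by (simp add: sq right_diff_distrib[symmetric] mult.assoc add.commute)
    finally show ?thesis .
  qed
  ultimately show ?thesis using that by blast
qed

text \<open>Concavity of \<omega> turns each decrease of \<open>H\<close> into a drop of
  \<open>v k = \<omega> (H (z k) - H zs)\<close>, and the KL inequality converts that drop into a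
  bound on \<open>d\<close>. The drops telescope, so the length is finite as long as the sequence
  stays near \<open>zs\<close>. The summable \<open>b\<close> collects all errors.\<close>

lemma KL_finite_length:
  fixes H :: "'a::euclidean_space \<Rightarrow> real" and z :: "nat \<Rightarrow> 'a" and d b :: "nat \<Rightarrow> real"
  assumes KL: "KL_property_at H zs"
    and H_lim: "(\<lambda>k. H (z k)) \<longlonglongrightarrow> H zs"
    and H_gt: "\<And>k. H zs < H (z k)"
    and r: "strict_mono r" "(z \<circ> r) \<longlonglongrightarrow> zs"
    and a: "0 < a" and M: "0 < M"
    and d0: "\<And>k. 0 \<le> d k"
    and b: "summable b" and b0: "\<And>k. 0 \<le> b k"
    and decrease: "\<And>k. H (z (Suc k)) + a * (d k)\<^sup>2 \<le> H (z k)"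
    and slope: "\<And>k. norm (gradient H (z (Suc k))) \<le> M * d k + b k"
    and step: "\<And>k. norm (z (Suc k) - z k) \<le> d k + b k"
  shows "summable d"
proof -
  define R where "R = M / a"
  have R: "0 < R" using a M by (simp add: R_def)
  obtain \<zeta> :: ereal and U \<omega> \<omega>' where \<zeta>: "0 < \<zeta>" and U: "zs \<in> interior U"
    and cont: "continuous_on {s. 0 \<le> s \<and> ereal s < \<zeta>} \<omega>"
    and conc: "concave_on {s. 0 \<le> s \<and> ereal s < \<zeta>} \<omega>"
    and nonneg: "\<And>s. 0 \<le> s \<Longrightarrow> ereal s < \<zeta> \<Longrightarrow> 0 \<le> \<omega> s"
    and \<omega>0: "\<omega> 0 = 0"
    and der: "\<And>s. 0 < s \<Longrightarrow> ereal s < \<zeta> \<Longrightarrow> (\<omega> has_real_derivative \<omega>' s) (at s)"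
    and pos: "\<And>s. 0 < s \<Longrightarrow> ereal s < \<zeta> \<Longrightarrow> 0 < \<omega>' s"
    and KLineq: "\<And>x. x \<in> U \<Longrightarrow> H zs < H x \<Longrightarrow> ereal (H x) < ereal (H zs) + \<zeta> \<Longrightarrow>
        \<omega>' (H x - H zs) * norm (gradient H x) \<ge> 1"
    using KL unfolding KL_property_at_def by blast
  define h where "h = (\<lambda>k. H (z k) - H zs)"
  define v where "v = (\<lambda>k. \<omega> (h k))"
  have h_lim: "h \<longlonglongrightarrow> 0"
    unfolding h_def using H_lim by (simp add: LIM_zero)
  have h_pos: "0 < h k" for k using H_gt[of k] by (simp add: h_def)
  have h_step: "h (Suc k) + a * (d k)\<^sup>2 \<le> h k" for k
    using decrease[of k] by (simp add: h_def)
  have h_small: "\<forall>\<^sub>F k in sequentially. ereal (h k) < \<zeta>"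
  proof -
    have "(\<lambda>k. ereal (h k)) \<longlonglongrightarrow> ereal 0"
      using h_lim by (intro tendsto_ereal)
    then show ?thesis
      using \<zeta> by (intro order_tendstoD(2)) (auto simp: zero_ereal_def)
  qed
  have v_lim: "v \<longlonglongrightarrow> 0"
    using continuous_on_tendsto_compose[OF cont h_lim] \<zeta> h_small h_pos
    by (auto simp: v_def \<omega>0 less_imp_le zero_ereal_def)
  \<comment> \<open>The tangent inequality is applied at an interior point of an interval:
    \<open>u\<close> strictly between \<open>s\<close> and \<zeta> makes \<open>s\<close> interior
    to \<open>{0..u}\<close> without leaving the domain of \<omega>.\<close>
  have tangent: "\<omega> s' \<le> \<omega> s + \<omega>' s * (s' - s)" if s: "0 < s" "ereal s < \<zeta>" "0 \<le> s'" "s' \<le> s" for s s'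
  proof -
    obtain u where u: "s < u" "ereal u < \<zeta>"
      using ereal_dense2[OF s(2)] by auto
    have "convex_on {0..u} (\<lambda>s. - \<omega> s)"
      using conc unfolding concave_on_def
      by (rule convex_on_subset)
        (use u le_less_trans[of "ereal _" "ereal u" \<zeta>] in \<open>auto\<close>)
    then have "- \<omega> s' - (- \<omega> s) \<ge> (- \<omega>' s) * (s' - s)"
      by (rule convex_on_imp_above_tangent[where A="{0..u}"])
        (use s u in \<open>auto intro!: derivative_intros DERIV_subset[OF der] \<close>)
    then show ?thesis by simp
  qed
  have d_lim: "d \<longlonglongrightarrow> 0"
  proof -
    have "(\<lambda>k. (h k - h (Suc k)) / a) \<longlonglongrightarrow> 0"
      using h_lim LIMSEQ_Suc[OF h_lim] a by (auto intro!: tendsto_eq_intros)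
    then have "(\<lambda>k. (d k)\<^sup>2) \<longlonglongrightarrow> 0"
    proof (rule Lim_null_comparison[rotated])
      show "\<forall>\<^sub>F k in sequentially. norm ((d k)\<^sup>2) \<le> (h k - h (Suc k)) / a"
        using h_step a by (auto simp: field_simps)
    qed
    then show ?thesis by simp
  qed
  define tail where "tail = (\<lambda>k. suminf b - sum b {..<k})"
  have tail_lim: "tail \<longlonglongrightarrow> 0"
    unfolding tail_def using summable_LIMSEQ[OF b] by (auto intro!: tendsto_eq_intros)
  have tail_ge: "(\<Sum>j<n. b (m + j)) \<le> tail m" for m n
  proof -
    have "sum b {..<m} + (\<Sum>j<n. b (m + j)) = sum b {..<m+n}"
      by (induction n) (auto simp: add.assoc[symmetric])
    also have "\<dots> \<le> suminf b"
      using b b0 by (intro sum_le_suminf) auto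
    finally show ?thesis by (simp add: tail_def)
  qed
  have tail_Suc: "tail (Suc m) \<le> tail m" for m
    using b0[of m] by (simp add: tail_def)
  obtain \<rho> where \<rho>: "0 < \<rho>" "ball zs \<rho> \<subseteq> U"
    using U by (meson mem_interior)
  \<comment> \<open>These are the quantities that will control the path after index
    \<open>Suc k\<close>: \<open>tail k\<close> enters once through \<open>step\<close> and once,
    divided by \<open>M\<close>, through the recursion \<open>key\<close>, and
    \<open>R * v (Suc k)\<close> is what remains of the telescoped drops.\<close>
  have "(\<lambda>k. d k + (1 + 1 / M) * tail k + R * v (Suc k)) \<longlonglongrightarrow> 0"
    using d_lim tail_lim LIMSEQ_Suc[OF v_lim] by (auto intro!: tendsto_eq_intros)
  then have "\<forall>\<^sub>F k in sequentially. d k + (1 + 1 / M) * tail k + R * v (Suc k) < \<rho> / 2"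
    using \<rho> by (intro order_tendstoD(2)) auto
  with h_small have "\<forall>\<^sub>F k in sequentially.
      ereal (h k) < \<zeta> \<and> d k + (1 + 1 / M) * tail k + R * v (Suc k) < \<rho> / 2"
    by (rule eventually_conj)
  then obtain K where K: "\<And>k. k \<ge> K \<Longrightarrow> ereal (h k) < \<zeta>"
      "\<And>k. k \<ge> K \<Longrightarrow> d k + (1 + 1 / M) * tail k + R * v (Suc k) < \<rho> / 2"
    unfolding eventually_sequentially by blast
  have "\<forall>\<^sub>F j in sequentially. dist ((z \<circ> r) j) zs < \<rho> / 2"
    using tendstoD[OF r(2), of "\<rho> / 2"] \<rho> by simp
  then obtain J where J: "\<And>j. j \<ge> J \<Longrightarrow> dist (z (r j)) zs < \<rho> / 2"
    by (auto simp: eventually_sequentially)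
  \<comment> \<open>The start \<open>Suc m\<close> is an index of the subsequence, hence close to
    \<open>zs\<close>; taking the maximum with \<open>Suc K\<close> ensures that its predecessor
    \<open>m\<close> still satisfies the smallness bounds.\<close>
  have "r (max J (Suc K)) \<ge> Suc K"
    using seq_suble[OF r(1), of "max J (Suc K)"] by simp
  then obtain m where m: "m \<ge> K" "Suc m = r (max J (Suc K))"
    by (metis Suc_le_D Suc_le_mono)
  have m_near: "norm (z (Suc m) - zs) < \<rho> / 2"
    using J[of "max J (Suc K)"] m by (simp add: dist_norm)
  have v_nonneg: "0 \<le> v k" if "k \<ge> K" for k
    using nonneg[of "h k"] K(1)[OF that] h_pos[of k] by (simp add: v_def)
  have am_gm: "4 * (X * Y) \<le> (X + Y)\<^sup>2" for X Y :: real
    using zero_le_power2[of "X - Y"] by (simp add: power2_eq_square algebra_simps)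
  \<comment> \<open>Decrease and the tangent at \<open>s\<close> give
    \<open>\<omega>' s * a * (d (Suc k))\<^sup>2 \<le> \<Delta>\<close>. Multiplying by the gradient
    norm, the KL inequality removes \<open>\<omega>' s\<close> and \<open>slope\<close> bounds the
    rest, so the square of \<open>d (Suc k)\<close> is at most
    \<open>(R * \<Delta>) * (d k + b k / M)\<close>. The arithmetic-geometric mean inequality then
    splits the product.\<close>
  have key: "2 * d (Suc k) \<le> d k + b k / M + R * (v (Suc k) - v (Suc (Suc k)))"
    if k: "k \<ge> K" and near: "z (Suc k) \<in> ball zs \<rho>" for k
  proof -
    define \<Delta> where "\<Delta> = v (Suc k) - v (Suc (Suc k))"
    define s where "s = h (Suc k)"
    have s: "0 < s" "ereal s < \<zeta>" using h_pos K k by (auto simp: s_def)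
    have s': "h (Suc (Suc k)) + a * (d (Suc k))\<^sup>2 \<le> s" using h_step by (simp add: s_def)
    have "0 \<le> a * (d (Suc k))\<^sup>2" using a by simp
    then have "\<omega> (h (Suc (Suc k))) \<le> \<omega> s + \<omega>' s * (h (Suc (Suc k)) - s)"
      using s' s h_pos[of "Suc (Suc k)"] by (intro tangent) auto
    moreover have "\<omega>' s * (a * (d (Suc k))\<^sup>2) \<le> \<omega>' s * (s - h (Suc (Suc k)))"
      using s' pos[OF s] by (intro mult_left_mono) auto
    ultimately have 1: "\<omega>' s * (a * (d (Suc k))\<^sup>2) \<le> \<Delta>"
      by (simp add: \<Delta>_def v_def s_def algebra_simps)
    have \<Delta>0: "0 \<le> \<Delta>" using 1 pos[OF s] a
      by (smt (verit) mult_nonneg_nonneg zero_le_power2)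
    have "ereal (H (z (Suc k))) < ereal (H zs) + \<zeta>"
      using s(2) by (cases \<zeta>) (auto simp: s_def h_def)
    then have 2: "1 \<le> \<omega>' s * norm (gradient H (z (Suc k)))"
      using KLineq[of "z (Suc k)"] near \<rho> H_gt by (auto simp: s_def h_def)
    have "a * (d (Suc k))\<^sup>2 \<le> (a * (d (Suc k))\<^sup>2) * (\<omega>' s * norm (gradient H (z (Suc k))))"
      using mult_left_mono[OF 2, of "a * (d (Suc k))\<^sup>2"] a by simp
    also have "\<dots> \<le> \<Delta> * norm (gradient H (z (Suc k)))"
      using mult_right_mono[OF 1, of "norm (gradient H (z (Suc k)))"] by (simp add: mult_ac)
    also have "\<dots> \<le> \<Delta> * (M * d k + b k)"
      using slope \<Delta>0 by (intro mult_left_mono) auto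
    also have "\<dots> = a * ((R * \<Delta>) * (d k + b k / M))"
      using a M by (simp add: R_def field_simps)
    finally have 3: "(d (Suc k))\<^sup>2 \<le> (R * \<Delta>) * (d k + b k / M)"
      using a by simp
    have "(2 * d (Suc k))\<^sup>2 \<le> 4 * ((R * \<Delta>) * (d k + b k / M))"
      using 3 by (simp add: power2_eq_square)
    also have "\<dots> \<le> (R * \<Delta> + (d k + b k / M))\<^sup>2"
      using am_gm .
    finally have "2 * d (Suc k) \<le> R * \<Delta> + (d k + b k / M)"
      by (rule power2_le_imp_le) (use R \<Delta>0 d0 b0 M in auto)
    then show ?thesis by (simp add: \<Delta>_def)
  qed
  \<comment> \<open>From index \<open>Suc m\<close> on the sequence never leaves the ball where the KL inequality holds:
    the path length is controlled by quantities that are already small at \<open>m\<close>.\<close>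
  have bound: "(\<Sum>j<n. d (Suc (m + j))) + d (m + n) + R * v (Suc (m + n))
        \<le> d m + (\<Sum>j<n. b (m + j)) / M + R * v (Suc m)
      \<and> norm (z (Suc (m + n)) - zs)
        \<le> norm (z (Suc m) - zs) + (\<Sum>j<n. d (Suc (m + j))) + (\<Sum>j<n. b (Suc (m + j)))" for n
  proof (induction n)
    case (Suc n)
    \<comment> \<open>Half of the radius \<rho> covers the distance of \<open>z (Suc m)\<close> from
      \<open>zs\<close>, the other half the path travelled since, so \<open>key\<close> is
      applicable at the next index.\<close>
    have "(\<Sum>j<n. b (Suc (m + j))) \<le> tail m"
      using tail_ge[of "Suc m" n] tail_Suc[of m] by simp
    moreover have "(\<Sum>j<n. b (m + j)) / M \<le> tail m / M"
      using tail_ge[of m n] M by (simp add: divide_right_mono)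
    moreover have "0 \<le> R * v (Suc (m + n))" "0 \<le> d (m + n)"
      using v_nonneg[of "Suc (m + n)"] m R d0 by auto
    moreover have "d m + (tail m + tail m / M) + R * v (Suc m) < \<rho> / 2"
      using K(2)[OF m(1)] by (simp add: distrib_right)
    ultimately have "norm (z (Suc (m + n)) - zs) < \<rho>"
      using Suc.IH m_near by linarith
    then have "2 * d (Suc (m + n))
        \<le> d (m + n) + b (m + n) / M + R * (v (Suc (m + n)) - v (Suc (Suc (m + n))))"
      using m by (intro key) (auto simp: dist_norm norm_minus_commute)
    moreover have "norm (z (Suc (Suc (m + n))) - zs)
        \<le> norm (z (Suc (Suc (m + n))) - z (Suc (m + n))) + norm (z (Suc (m + n)) - zs)"
      using norm_triangle_ineq[of "z (Suc (Suc (m + n))) - z (Suc (m + n))" "z (Suc (m + n)) - zs"] by simp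
    ultimately show ?case
      using Suc.IH step[of "Suc (m + n)"] by (simp add: algebra_simps add_divide_distrib)
  qed simp
  have "summable (\<lambda>j. d (Suc (m + j)))"
  proof (rule bounded_imp_summable)
    fix n
    have "(\<Sum>j<Suc n. b (m + j)) / M \<le> tail m / M"
      using tail_ge[of m "Suc n"] M by (simp only: divide_right_mono)
    moreover have "0 \<le> R * v (Suc (m + Suc n))" "0 \<le> d (m + Suc n)"
      using v_nonneg[of "Suc (m + Suc n)"] m R d0 by auto
    ultimately show "(\<Sum>j\<le>n. d (Suc (m + j))) \<le> d m + tail m / M + R * v (Suc m)"
      using bound[of "Suc n"] unfolding lessThan_Suc_atMost by linarith
  qed (use d0 in auto)
  then show ?thesis
    using summable_iff_shift[of d "Suc m"] by (simp add: add.commute)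
qed

subsection \<open>The potential and the regularizer of an LPN\<close>

lemma icnn_layer_differentiable:
  assumes "\<forall>t. \<sigma> differentiable (at t)"
  shows "(\<lambda>x. icnn_layer \<sigma> \<theta> x i j) differentiable (at x)"
proof (induction i arbitrary: j)
  case (Suc i)
  show ?case
    unfolding icnn_layer.simps
    by (rule differentiable_compose[of \<sigma>])
       (use assms Suc in \<open>auto intro!: differentiable_add differentiable_sum differentiable_mult
          bounded_linear_imp_differentiable[OF bounded_linear_inner_right]\<close>)
qed simp

text \<open>Each layer composes an affine map of the previous layer and the input with the Lipschitz
  \<sigma>. The resulting linear growth of the network is what makes the regularizer
  coercive.\<close>

lemma icnn_layer_lipschitz:
  assumes "L-lipschitz_on UNIV \<sigma>"
  shows "\<exists>M. \<forall>x y. \<bar>icnn_layer \<sigma> \<theta> x i j - icnn_layer \<sigma> \<theta> y i j\<bar> \<le> M * norm (x - y)"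
proof (induction i arbitrary: j)
  case 0
  show ?case by (auto intro!: exI[of _ 0])
next
  case (Suc i)
  have "\<forall>l. \<exists>M. \<forall>x y. \<bar>icnn_layer \<sigma> \<theta> x i l - icnn_layer \<sigma> \<theta> y i l\<bar> \<le> M * norm (x - y)"
    using Suc by blast
  then obtain M where M: "\<And>l x y. \<bar>icnn_layer \<sigma> \<theta> x i l - icnn_layer \<sigma> \<theta> y i l\<bar> \<le> M l * norm (x - y)"
    by metis
  define W where "W = icnn_W \<theta> i j"
  define h where "h = icnn_H \<theta> i j"
  let ?n = "icnn_width \<theta> i"
  let ?z = "\<lambda>x. (\<Sum>l<?n. W l * icnn_layer \<sigma> \<theta> x i l) + h \<bullet> x + icnn_b \<theta> i j"
  have L: "0 \<le> L" using assms by (rule lipschitz_on_nonneg)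
  have "\<bar>\<sigma> (?z x) - \<sigma> (?z y)\<bar> \<le> L * ((\<Sum>l<?n. \<bar>W l\<bar> * M l) + norm h) * norm (x - y)" for x y
  proof -
    have "?z x - ?z y = (\<Sum>l<?n. W l * (icnn_layer \<sigma> \<theta> x i l - icnn_layer \<sigma> \<theta> y i l)) + h \<bullet> (x - y)"
      by (simp add: sum_subtractf right_diff_distrib inner_diff_right)
    also have "\<bar>\<dots>\<bar> \<le> (\<Sum>l<?n. \<bar>W l * (icnn_layer \<sigma> \<theta> x i l - icnn_layer \<sigma> \<theta> y i l)\<bar>) + \<bar>h \<bullet> (x - y)\<bar>"
      by (intro order_trans[OF abs_triangle_ineq] add_mono sum_abs order_refl)
    also have "\<dots> \<le> (\<Sum>l<?n. \<bar>W l\<bar> * (M l * norm (x - y))) + norm h * norm (x - y)"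
      using M by (intro add_mono sum_mono) (auto simp: abs_mult Cauchy_Schwarz_ineq2 intro!: mult_left_mono)
    also have "\<dots> = ((\<Sum>l<?n. \<bar>W l\<bar> * M l) + norm h) * norm (x - y)"
      by (simp add: sum_distrib_right distrib_right mult.assoc)
    finally have z: "\<bar>?z x - ?z y\<bar> \<le> \<dots>" .
    have "\<bar>\<sigma> (?z x) - \<sigma> (?z y)\<bar> \<le> L * \<bar>?z x - ?z y\<bar>"
      using lipschitz_onD[OF assms, of "?z x" "?z y"] by (simp add: dist_real_def)
    also have "\<dots> \<le> L * (((\<Sum>l<?n. \<bar>W l\<bar> * M l) + norm h) * norm (x - y))"
      using z L by (rule mult_left_mono)
    finally show ?thesis by (simp add: mult.assoc)
  qed
  then show ?case
    unfolding icnn_layer.simps W_def h_def by blast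
qed

context
  fixes \<sigma> :: "real \<Rightarrow> real" and \<theta> :: "'a::euclidean_space icnn_params"
    and \<alpha> :: real and f :: "'a \<Rightarrow> 'a"
  assumes LPN: "is_LPN \<sigma> \<theta> \<alpha> f"
begin

text \<open>The exact expansion of the quadratic term around \<open>v\<close> is added to the
  subgradient inequality of the network; its second-order remainder is the strong convexity
  term.\<close>

lemma LPN_potential_strongly_convex:
  "LPN_potential \<sigma> \<theta> \<alpha> v + f v \<bullet> (u - v) + \<alpha> / 2 * (norm (u - v))\<^sup>2 \<le> LPN_potential \<sigma> \<theta> \<alpha> u"
proof -
  obtain g where g: "g \<in> subdifferential (icnn \<sigma> \<theta>) v" "f v = g + \<alpha> *\<^sub>R v"
    using LPN unfolding is_LPN_def by blast
  have "icnn \<sigma> \<theta> u \<ge> icnn \<sigma> \<theta> v + g \<bullet> (u - v)"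
    using g(1) by (auto simp: subdifferential_def)
  moreover have "\<alpha> / 2 * (norm u)\<^sup>2
      = \<alpha> / 2 * (norm v)\<^sup>2 + (\<alpha> *\<^sub>R v) \<bullet> (u - v) + \<alpha> / 2 * (norm (u - v))\<^sup>2"
    unfolding power2_norm_eq_inner by (simp add: algebra_simps inner_commute field_simps)
  ultimately show ?thesis
    unfolding LPN_potential_def g(2) inner_add_left by linarith
qed

text \<open>An LPN selects some subgradient of the network; where the network is differentiable,
  that can only be its gradient.\<close>

lemma LPN_potential_GDERIV:
  assumes "\<forall>t. \<sigma> differentiable (at t)"
  shows "GDERIV (LPN_potential \<sigma> \<theta> \<alpha>) v :> f v"
proof -
  obtain g where g: "g \<in> subdifferential (icnn \<sigma> \<theta>) v" "f v = g + \<alpha> *\<^sub>R v"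
    using LPN unfolding is_LPN_def by blast
  have "icnn \<sigma> \<theta> differentiable (at v)"
    unfolding icnn_def using icnn_layer_differentiable[OF assms] .
  from subgradient_imp_GDERIV[OF this g(1)] show ?thesis
    unfolding gderiv_def LPN_potential_def power2_norm_eq_inner g(2)
    by (auto intro!: derivative_eq_intros simp: inner_commute algebra_simps)
qed

text \<open>Strong convexity at 0 and Young's inequality for \<open>u \<bullet> (y - f 0)\<close>:
  the quadratic in \<open>u\<close> cancels. This is the finiteness of the conjugate at every
  \<open>y\<close>.\<close>

lemma LPN_conjugate_bounded: "u \<bullet> y - LPN_potential \<sigma> \<theta> \<alpha> u
    \<le> (norm (y - f 0))\<^sup>2 / (2 * \<alpha>) - LPN_potential \<sigma> \<theta> \<alpha> 0"
proof -
  have \<alpha>: "0 < \<alpha>" using LPN by (simp add: is_LPN_def)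
  have "u \<bullet> (y - f 0) \<le> norm u * norm (y - f 0)"
    by (rule norm_cauchy_schwarz)
  also have "\<dots> \<le> (norm (y - f 0))\<^sup>2 / (2 * \<alpha>) + \<alpha> / 2 * (norm u)\<^sup>2"
    using zero_le_power2[of "norm (y - f 0) - \<alpha> * norm u"] \<alpha>
    by (simp add: field_simps power2_eq_square)
  finally show ?thesis
    using LPN_potential_strongly_convex[of 0 u] by (simp add: inner_diff_right inner_commute)
qed

lemma LPN_regularizer_ge:
  "u \<bullet> y - LPN_potential \<sigma> \<theta> \<alpha> u - (norm y)\<^sup>2 / 2 \<le> LPN_regularizer \<sigma> \<theta> \<alpha> y"
  using convex_conjugate_ge[of y, OF LPN_conjugate_bounded, of u] by (simp add: LPN_regularizer_def)

text \<open>Equality in Fenchel-Young: \<open>f v\<close> is a subgradient of the potential at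
  \<open>v\<close>, so \<open>v\<close> attains the supremum defining the conjugate at
  \<open>f v\<close>.\<close>

lemma LPN_regularizer_image:
  "LPN_regularizer \<sigma> \<theta> \<alpha> (f v) = v \<bullet> f v - LPN_potential \<sigma> \<theta> \<alpha> v - (norm (f v))\<^sup>2 / 2"
proof -
  have "u \<bullet> f v - LPN_potential \<sigma> \<theta> \<alpha> u \<le> v \<bullet> f v - LPN_potential \<sigma> \<theta> \<alpha> v" for u
  proof -
    have "0 \<le> \<alpha> / 2 * (norm (u - v))\<^sup>2" using LPN by (simp add: is_LPN_def)
    then show ?thesis
      using LPN_potential_strongly_convex[of v u]
      by (simp add: inner_diff_right inner_commute)
  qed
  from convex_conjugate_attained[where y = "f v", OF this] show ?thesis
    by (simp add: LPN_regularizer_def)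
qed

text \<open>Adding half the squared norm to the regularizer gives the conjugate, which has
  \<open>v\<close> as a subgradient at \<open>f v\<close>; expanding the squares around
  \<open>f v\<close> turns this into the stated inequality.\<close>

lemma LPN_regularizer_weakly_convex:
  "LPN_regularizer \<sigma> \<theta> \<alpha> (f v) + (v - f v) \<bullet> (u - f v) - (norm (u - f v))\<^sup>2 / 2
    \<le> LPN_regularizer \<sigma> \<theta> \<alpha> u"
  using LPN_regularizer_ge[of v u]
  unfolding LPN_regularizer_image power2_norm_eq_inner
  by (simp add: algebra_simps inner_commute field_simps)

lemma LPN_regularizer_GDERIV:
  assumes "LPN_regularizer \<sigma> \<theta> \<alpha> differentiable (at (f v))"
  shows "GDERIV (LPN_regularizer \<sigma> \<theta> \<alpha>) (f v) :> v - f v"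
proof -
  let ?P = "\<lambda>u. LPN_regularizer \<sigma> \<theta> \<alpha> u + u \<bullet> u / 2"
  have sq: "GDERIV (\<lambda>u. u \<bullet> u / 2) u :> u" for u :: 'a
    unfolding gderiv_def by (auto intro!: derivative_eq_intros simp: inner_commute)
  have "(\<lambda>u. u \<bullet> u / 2) differentiable (at (f v))"
    using sq unfolding gderiv_def differentiable_def by blast
  with assms have "?P differentiable (at (f v))"
    by (rule differentiable_add)
  moreover have "v \<in> subdifferential ?P (f v)"
    using LPN_regularizer_ge[of v]
    by (simp add: subdifferential_def LPN_regularizer_image power2_norm_eq_inner algebra_simps)
  ultimately have "GDERIV ?P (f v) :> v"
    by (rule subgradient_imp_GDERIV)
  from GDERIV_diff[OF this sq] show ?thesis by simp
qed

text \<open>Choosing \<open>u\<close> itself as the competitor in the supremum defining the conjugate at \<open>u\<close>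
  leaves the quadratic part \<open>(1 - \<alpha>) / 2 * (norm u)\<^sup>2\<close> and an error that is only linear in
  \<open>norm u\<close>, the network being Lipschitz.\<close>

lemma LPN_regularizer_coercive: "\<exists>K. \<forall>u. norm u - K \<le> LPN_regularizer \<sigma> \<theta> \<alpha> u"
proof -
  obtain S where "S-lipschitz_on UNIV \<sigma>" using LPN by (auto simp: is_LPN_def)
  from icnn_layer_lipschitz[OF this, of \<theta> "icnn_depth \<theta>" 0] obtain M where
    M: "\<And>x y. \<bar>icnn \<sigma> \<theta> x - icnn \<sigma> \<theta> y\<bar> \<le> M * norm (x - y)"
    by (auto simp: icnn_def)
  define a where "a = (1 - \<alpha>) / 2"
  have a: "0 < a" using LPN by (simp add: a_def is_LPN_def)
  have "norm u - ((M + 1)\<^sup>2 / (4 * a) + icnn \<sigma> \<theta> 0) \<le> LPN_regularizer \<sigma> \<theta> \<alpha> u" for u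
  proof -
    have "icnn \<sigma> \<theta> u \<le> icnn \<sigma> \<theta> 0 + M * norm u"
      using M[of u 0] by simp
    moreover have "u \<bullet> u = (norm u)\<^sup>2"
      by (simp add: power2_norm_eq_inner)
    ultimately have "a * (norm u)\<^sup>2 - M * norm u - icnn \<sigma> \<theta> 0 \<le> LPN_regularizer \<sigma> \<theta> \<alpha> u"
      using LPN_regularizer_ge[of u u]
      by (simp add: LPN_potential_def a_def algebra_simps diff_divide_distrib)
    \<comment> \<open>Completing the square with slope \<open>M + 1\<close> instead of
      \<open>M\<close> leaves the term \<open>norm u\<close> over.\<close>
    moreover have "norm u - (M + 1)\<^sup>2 / (4 * a) \<le> a * (norm u)\<^sup>2 - M * norm u"
      using zero_le_power2[of "2 * a * norm u - (M + 1)"] a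
      by (simp add: field_simps power2_eq_square)
    ultimately show ?thesis by simp
  qed
  then show ?thesis by blast
qed

end

subsection \<open>Convergence of the iterates\<close>

lemma GDERIV_add_half_square:
  fixes F :: "'a::real_inner \<Rightarrow> real"
  assumes "GDERIV F u :> D"
  shows "GDERIV (\<lambda>(u, t). F u + 1 / 2 * t\<^sup>2 :: real) (u, t) :> (D, t)"
proof -
  have "(F has_derivative (\<lambda>h. h \<bullet> D)) (at (fst (u, t)))"
    using assms by (simp add: gderiv_def)
  from has_derivative_compose[OF has_derivative_fst[OF has_derivative_ident] this]
  have "((\<lambda>z. F (fst z)) has_derivative (\<lambda>h. fst h \<bullet> D)) (at (u, t))" .
  moreover have "((\<lambda>z :: 'a \<times> real. 1 / 2 * (snd z)\<^sup>2) has_derivative (\<lambda>h. snd h * t)) (at (u, t))"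
    by (auto intro!: derivative_eq_intros)
  ultimately have "((\<lambda>z. F (fst z) + 1 / 2 * (snd z)\<^sup>2) has_derivative
      (\<lambda>h. fst h \<bullet> D + snd h * t)) (at (u, t))"
    by (rule has_derivative_add)
  then show ?thesis
    by (simp add: gderiv_def case_prod_unfold inner_prod_def)
qed

text \<open>The KL property includes continuous differentiability of \<xi>; restricting to the slice
  of second coordinate 0 passes it on to \<open>F\<close>.\<close>

lemma continuously_differentiable_slice:
  fixes F :: "'a::euclidean_space \<Rightarrow> real"
  assumes "continuously_differentiable (\<lambda>(u, t). F u + 1 / 2 * t\<^sup>2 :: real)"
  shows "continuously_differentiable F"
proof -
  let ?H = "\<lambda>(u, t). F u + 1 / 2 * t\<^sup>2 :: real"
  have F: "F differentiable (at u)" for u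
  proof -
    have "(\<lambda>u. (u, 0::real)) differentiable (at u)"
      by (intro bounded_linear_imp_differentiable bounded_linear_Pair bounded_linear_ident bounded_linear_zero)
    moreover have "?H differentiable (at (u, 0))"
      using assms unfolding continuously_differentiable_def by blast
    ultimately have "(?H \<circ> (\<lambda>u. (u, 0))) differentiable (at u)"
      by (rule differentiable_chain_at)
    then show ?thesis by (simp add: o_def)
  qed
  have "gradient F u = fst (gradient ?H (u, 0))" for u
    using gradient_eqI[OF GDERIV_add_half_square[OF GDERIV_gradient[OF F]], of u 0] by simp
  then have "gradient F = (\<lambda>u. fst (gradient ?H (u, 0)))" by blast
  moreover have "continuous_on UNIV (\<lambda>u. fst (gradient ?H (u, 0)))"
  proof -
    have "continuous_on UNIV (gradient ?H)"
      using assms unfolding continuously_differentiable_def by blast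
    moreover have "continuous_on UNIV (\<lambda>u :: 'a. (u, 0 :: real))"
      by (intro continuous_intros)
    ultimately have "continuous_on UNIV (\<lambda>u. gradient ?H (u, 0))"
      by (rule continuous_on_compose2) simp
    then show ?thesis by (rule continuous_on_fst)
  qed
  ultimately show ?thesis
    unfolding continuously_differentiable_def using F by simp
qed

theorem proposition4p7:
  fixes \<sigma> :: "real \<Rightarrow> real"
    and \<theta> :: "(real ^ 'n) icnn_params"
    and \<alpha> L \<eta> \<gamma> C p :: real
    and f :: "real ^ 'n \<Rightarrow> real ^ 'n"
    and fid F :: "real ^ 'n \<Rightarrow> real"
    and G :: "nat \<Rightarrow> real ^ 'n \<Rightarrow> real"
    and x w :: "nat \<Rightarrow> real ^ 'n"
  assumes "is_LPN \<sigma> \<theta> \<alpha> f"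
    and "\<forall>t. \<sigma> differentiable (at t)"
    and "L > 0" and "L_smooth L fid" and "bdd_below (range fid)"
    and "0 < \<eta>" and "\<eta> < 1 / L"
    and "0 < \<gamma>" and "\<gamma> \<le> 1"
    and "C > 0" and "p > 3 / 2"
    and "\<And>k v. G k v = \<gamma> / 2 * (norm v)\<^sup>2 + (1 - \<gamma>) * LPN_potential \<sigma> \<theta> \<alpha> v
                        - (x k - \<eta> *\<^sub>R gradient fid (x k)) \<bullet> v"
    and "\<And>k. norm (gradient (G k) (w (k + 1))) \<le> C / real (k + 1) powr p"
    and "\<And>k. x (k + 1) = f (w (k + 1))"
    and "\<And>u. F u = \<eta> * fid u + \<gamma> * LPN_regularizer \<sigma> \<theta> \<alpha> u"
  shows "convergent (\<lambda>k. F (x k))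
    \<and> summable (\<lambda>k. (norm (x (k + 1) - x (k + 2)))\<^sup>2)
    \<and> (KL_function (\<lambda>(u, t). F u + 1 / 2 * t\<^sup>2 :: real) \<longrightarrow>
         summable (\<lambda>k. norm (x (k + 1) - x (k + 2)))
         \<and> (\<exists>x_lim. x \<longlonglongrightarrow> x_lim \<and> critical_point F x_lim))"
proof -
  note LPN = assms(1) and smooth = \<open>L_smooth L fid\<close>
  note G_def = assms(12) and inexact = assms(13) and x_step = assms(14) and F_def = assms(15)
  let ?\<Psi> = "LPN_potential \<sigma> \<theta> \<alpha>" and ?\<phi> = "LPN_regularizer \<sigma> \<theta> \<alpha>" and ?g = "gradient fid"
  \<comment> \<open>The coefficient of the squared step in the descent estimate: 1 from
    \<open>(e k - d k) \<bullet> d k\<close>, less \<open>\<eta> * L / 2\<close> from the smoothness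
    of \<open>fid\<close> and \<open>\<gamma> / 2\<close> from the weak convexity of the
    regularizer.\<close>
  define c where "c = 1 - (\<eta> * L + \<gamma>) / 2"
  define d where "d = (\<lambda>k. x (Suc k) - x k)"
  define \<epsilon> where "\<epsilon> = (\<lambda>k. C / real (k + 1) powr p)"
  define e where "e = (\<lambda>k. \<gamma> *\<^sub>R w (Suc k) + (1 - \<gamma>) *\<^sub>R x (Suc k) - (x k - \<eta> *\<^sub>R ?g (x k)))"
  have "\<eta> * L < 1" using assms by (simp add: field_simps)
  then have c: "0 < c" using \<open>\<gamma> \<le> 1\<close> by (simp add: c_def)

  \<comment> \<open>Inexactness and descent in one step\<close>
  have e_le: "norm (e k) \<le> \<epsilon> k" for k
  proof -
    have "GDERIV ?\<Psi> v :> f v" for v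
      using LPN_potential_GDERIV[OF LPN assms(2)] .
    then have "GDERIV (G k) v :> \<gamma> *\<^sub>R v + (1 - \<gamma>) *\<^sub>R f v - (x k - \<eta> *\<^sub>R ?g (x k))" for v
      unfolding gderiv_def G_def[abs_def] power2_norm_eq_inner
      by (auto intro!: derivative_eq_intros simp: inner_commute algebra_simps)
    then have "gradient (G k) (w (k + 1)) = e k"
      using x_step[of k] by (simp add: gradient_eqI e_def)
    then show ?thesis using inexact[of k] by (simp add: \<epsilon>_def)
  qed

  \<comment> \<open>The descent lemma times \<eta> is added to weak convexity times \<gamma>.
    Young's inequality then spends half of the coefficient \<open>c\<close> on absorbing
    \<open>e k \<bullet> d k\<close>.\<close>
  have descent: "F (x (Suc k)) + c / 2 * (norm (d k))\<^sup>2 \<le> F (x k) + (\<epsilon> k)\<^sup>2 / (2 * c)" for k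
  proof -
    have fid: "fid (x (Suc k)) \<le> fid (x k) + ?g (x k) \<bullet> d k + L / 2 * (norm (d k))\<^sup>2"
      using L_smooth_descent[OF smooth] by (simp add: d_def)
    have "?\<phi> (x (Suc k)) + (w (Suc k) - x (Suc k)) \<bullet> (- d k) - (norm (d k))\<^sup>2 / 2 \<le> ?\<phi> (x k)"
      using LPN_regularizer_weakly_convex[OF LPN, of "w (Suc k)" "x k"] x_step[of k]
      by (simp add: d_def norm_minus_commute)
    then have \<phi>: "?\<phi> (x (Suc k)) \<le> ?\<phi> (x k) + (w (Suc k) - x (Suc k)) \<bullet> d k + (norm (d k))\<^sup>2 / 2"
      by simp
    have "F (x (Suc k)) \<le> F (x k)
        + (\<eta> *\<^sub>R ?g (x k) + \<gamma> *\<^sub>R (w (Suc k) - x (Suc k))) \<bullet> d k + (\<eta> * L + \<gamma>) / 2 * (norm (d k))\<^sup>2"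
      using mult_left_mono[OF fid, of \<eta>] mult_left_mono[OF \<phi>, of \<gamma>] \<open>0 < \<eta>\<close> \<open>0 < \<gamma>\<close>
      unfolding F_def by (simp add: inner_add_left algebra_simps add_divide_distrib)
    also have "\<eta> *\<^sub>R ?g (x k) + \<gamma> *\<^sub>R (w (Suc k) - x (Suc k)) = e k - d k"
      by (simp add: e_def d_def algebra_simps)
    finally have F: "F (x (Suc k)) \<le> F (x k) + e k \<bullet> d k - c * (norm (d k))\<^sup>2"
      by (simp add: inner_diff_left c_def power2_norm_eq_inner algebra_simps)
    have "e k \<bullet> d k \<le> norm (e k) * norm (d k)"
      by (rule norm_cauchy_schwarz)
    also have "\<dots> \<le> \<epsilon> k * norm (d k)"
      using e_le by (intro mult_right_mono) auto
    also have "\<dots> \<le> c / 2 * (norm (d k))\<^sup>2 + (\<epsilon> k)\<^sup>2 / (2 * c)"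
      using zero_le_power2[of "c * norm (d k) - \<epsilon> k"] c
      by (simp add: field_simps power2_eq_square)
    finally show ?thesis using F by simp
  qed

  \<comment> \<open>The constant \<open>C\<^sup>2 / c\<close> is twice the error coefficient in
    \<open>descent\<close>, because \<open>t\<close> enters \<open>h\<close> as half its
    square.\<close>
  obtain t where t_pos: "\<And>k. 0 < t k" and t_sum: "summable t"
    and t_sq: "\<And>k. C\<^sup>2 / c * (1 / real (k + 1) powr p)\<^sup>2 < (t k)\<^sup>2 - (t (Suc k))\<^sup>2"
    using power_decay_telescoping[of p "C\<^sup>2 / c"] \<open>p > 3 / 2\<close> \<open>C > 0\<close> c by auto
  have t_lim: "t \<longlonglongrightarrow> 0" using t_sum by (rule summable_LIMSEQ_zero)
  define h where "h = (\<lambda>k. F (x k) + 1 / 2 * (t k)\<^sup>2)"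
  have h_less: "h (Suc k) + c / 2 * (norm (d k))\<^sup>2 < h k" for k
  proof -
    have "(\<epsilon> k)\<^sup>2 / (2 * c) = C\<^sup>2 / c * (1 / real (k + 1) powr p)\<^sup>2 / 2"
      by (simp add: \<epsilon>_def power_divide)
    then show ?thesis using descent[of k] t_sq[of k] by (simp add: h_def)
  qed
  have h_Suc: "h (Suc k) < h k" for k
  proof -
    have "0 \<le> c / 2 * (norm (d k))\<^sup>2" using c by simp
    with h_less[of k] show ?thesis by linarith
  qed

  \<comment> \<open>Lower bounds and convergence of the values\<close>
  obtain K where K: "\<And>u. norm u - K \<le> ?\<phi> u"
    using LPN_regularizer_coercive[OF LPN] by blast
  obtain m where m: "\<And>u. m \<le> fid u"
    using \<open>bdd_below (range fid)\<close> by (auto simp: bdd_below_def)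
  have F_ge: "\<gamma> * norm u \<le> F u - \<eta> * m + \<gamma> * K" for u
  proof -
    have "\<gamma> * (norm u - K) \<le> \<gamma> * ?\<phi> u" and "\<eta> * m \<le> \<eta> * fid u"
      using K m \<open>0 < \<eta>\<close> \<open>0 < \<gamma>\<close> by (auto intro!: mult_left_mono)
    then show ?thesis unfolding F_def right_diff_distrib by linarith
  qed
  have h_ge: "\<gamma> * norm (x k) + (\<eta> * m - \<gamma> * K) \<le> h k" for k
    using F_ge[of "x k"] zero_le_power2[of "t k"] unfolding h_def by linarith
  have h_dec: "decseq h"
    using h_Suc by (intro decseq_SucI less_imp_le)
  have "\<eta> * m - \<gamma> * K \<le> h k" for k
  proof -
    have "0 \<le> \<gamma> * norm (x k)" using \<open>0 < \<gamma>\<close> by simp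
    with h_ge[of k] show ?thesis by linarith
  qed
  then obtain l where h_lim: "h \<longlonglongrightarrow> l" and h_l: "\<And>k. l \<le> h k"
    using decseq_convergent[OF h_dec] by blast
  \<comment> \<open>Strict decrease keeps every value above the limit, so
    \<open>KL_finite_length\<close> applies with no separate case of the limit value being
    reached.\<close>
  have h_gt: "l < h k" for k using h_l[of "Suc k"] h_Suc[of k] by simp
  have "(\<lambda>k. h k - 1 / 2 * (t k)\<^sup>2) \<longlonglongrightarrow> l - 1 / 2 * 0\<^sup>2"
    by (intro tendsto_intros h_lim t_lim)
  then have F_lim: "(\<lambda>k. F (x k)) \<longlonglongrightarrow> l" by (simp add: h_def)

  have "summable (\<lambda>k. c / 2 * (norm (d k))\<^sup>2)"
  proof (rule summable_comparison_test'[OF telescope_summable'[OF h_lim], of 0])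
    fix k
    have "0 \<le> c / 2 * (norm (d k))\<^sup>2" using c by simp
    with h_less[of k] show "norm (c / 2 * (norm (d k))\<^sup>2) \<le> h k - h (Suc k)"
      unfolding real_norm_def by linarith
  qed
  then have d_sq: "summable (\<lambda>k. (norm (d k))\<^sup>2)"
    using c by (simp add: summable_cmult_iff)

  have shift: "norm (x (k + 1) - x (k + 2)) = norm (d (Suc k))" for k
    by (simp add: d_def norm_minus_commute)

  \<comment> \<open>Finite length and criticality of the limit under the KL assumption\<close>
  have "summable (\<lambda>k. norm (x (k + 1) - x (k + 2)))
      \<and> (\<exists>x_lim. x \<longlonglongrightarrow> x_lim \<and> critical_point F x_lim)"
    if KL: "KL_function (\<lambda>(u, t). F u + 1 / 2 * t\<^sup>2 :: real)"
  proof -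
    let ?H = "\<lambda>(u, t). F u + 1 / 2 * t\<^sup>2 :: real"
    define z where "z = (\<lambda>k. (x k, t k))"
    have KL_H: "KL_property_at ?H (u, s)" for u s
      using KL unfolding KL_function_def ..
    then have "continuously_differentiable ?H"
      unfolding KL_property_at_def by (rule conjunct1)
    then have "continuously_differentiable F"
      by (rule continuously_differentiable_slice)
    then have F_diff: "\<And>u. F differentiable (at u)" and F_cont: "\<And>u. isCont (gradient F) u"
      by (auto simp: continuously_differentiable_def continuous_on_eq_continuous_at)
    have grad_F: "GDERIV F u :> gradient F u" for u
      using F_diff by (rule GDERIV_gradient)
    have grad_H: "gradient ?H (u, s) = (gradient F u, s)" for u s
      by (rule gradient_eqI[OF GDERIV_add_half_square[OF grad_F]])
    \<comment> \<open>The step equation contains the gradient of \<open>fid\<close> at the old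
      point; exchanging it for the one at the new point costs a difference that the Lipschitz bound
      controls by \<open>norm (d k)\<close>.\<close>
    have grad_step: "gradient F (x (Suc k)) = \<eta> *\<^sub>R (?g (x (Suc k)) - ?g (x k)) + e k - d k" for k
    proof -
      have fid: "GDERIV fid u :> ?g u" for u
        using smooth by (intro GDERIV_gradient) (simp add: L_smooth_def)
      \<comment> \<open>Solving for the regularizer gives its differentiability from that of
        \<open>F\<close> and \<open>fid\<close>.\<close>
      have "?\<phi> = (\<lambda>u. inverse \<gamma> * (F u - \<eta> * fid u))"
        using \<open>0 < \<gamma>\<close> by (auto simp: F_def)
      moreover have "(\<lambda>u. inverse \<gamma> * (F u - \<eta> * fid u)) differentiable (at u)" for u
        using F_diff smooth by (auto simp: L_smooth_def intro!: derivative_intros)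
      ultimately have \<phi>: "GDERIV ?\<phi> (x (Suc k)) :> w (Suc k) - x (Suc k)"
        using LPN_regularizer_GDERIV[OF LPN, of "w (Suc k)"] x_step[of k] by simp
      have "GDERIV F (x (Suc k)) :> \<eta> *\<^sub>R ?g (x (Suc k)) + \<gamma> *\<^sub>R (w (Suc k) - x (Suc k))"
        using fid[of "x (Suc k)"] \<phi> unfolding gderiv_def F_def[abs_def]
        by (auto intro!: derivative_eq_intros simp: inner_add_right)
      from gradient_eqI[OF this] show ?thesis
        by (simp add: e_def d_def algebra_simps)
    qed
    have grad_le: "norm (gradient F (x (Suc k))) \<le> (\<eta> * L + 1) * norm (d k) + \<epsilon> k" for k
    proof -
      have "norm (?g (x (Suc k)) - ?g (x k)) \<le> L * norm (d k)"
        using lipschitz_onD[of L UNIV ?g] smooth by (auto simp: L_smooth_def d_def dist_norm)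
      then have "norm (\<eta> *\<^sub>R (?g (x (Suc k)) - ?g (x k))) \<le> \<eta> * (L * norm (d k))"
        using \<open>0 < \<eta>\<close> by simp
      then show ?thesis
        using norm_triangle_ineq[of "\<eta> *\<^sub>R (?g (x (Suc k)) - ?g (x k))" "e k"]
          norm_triangle_ineq4[of "\<eta> *\<^sub>R (?g (x (Suc k)) - ?g (x k)) + e k" "d k"] e_le[of k]
        unfolding grad_step by (simp add: algebra_simps)
    qed

    have "\<gamma> * norm (x k) \<le> h 0 - (\<eta> * m - \<gamma> * K)" for k
      using h_ge[of k] decseqD[OF h_dec, of 0 k] by simp
    then have "norm (x k) \<le> (h 0 - (\<eta> * m - \<gamma> * K)) / \<gamma>" for k
      using \<open>0 < \<gamma>\<close> by (simp add: field_simps)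
    then have "bounded (range x)"
      by (auto simp: bounded_iff)
    then obtain xs r where r: "strict_mono r" "(x \<circ> r) \<longlonglongrightarrow> xs"
      using bounded_imp_convergent_subsequence by blast
    have "isCont F xs"
      using F_diff by (rule differentiable_imp_continuous_within)
    then have "(\<lambda>k. F ((x \<circ> r) k)) \<longlonglongrightarrow> F xs"
      using r(2) by (rule isCont_tendsto_compose)
    moreover have "(\<lambda>k. F ((x \<circ> r) k)) \<longlonglongrightarrow> l"
      using LIMSEQ_subseq_LIMSEQ[OF F_lim r(1)] by (simp add: o_def)
    ultimately have l: "l = F xs" by (rule LIMSEQ_unique[symmetric])

    have \<epsilon>0: "0 \<le> \<epsilon> k" for k using \<open>C > 0\<close> by (simp add: \<epsilon>_def)
    have "summable (\<lambda>k. real k powr (- p))"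
      using \<open>p > 3 / 2\<close> by (simp add: summable_real_powr_iff)
    then have "summable (\<lambda>k. real (k + 1) powr (- p))"
      using summable_iff_shift[of "\<lambda>k. real k powr (- p)" 1] by blast
    then have "summable (\<lambda>k. C * real (k + 1) powr (- p))"
      by (rule summable_mult)
    then have \<epsilon>_sum: "summable \<epsilon>" by (simp add: \<epsilon>_def powr_minus_divide)

    \<comment> \<open>One error sequence serves both bounds: \<open>\<epsilon> k\<close> and the
      component \<open>t (Suc k)\<close> come from the gradient of \<xi>, while
      \<open>t k + t (Suc k)\<close> dominates the change of the second coordinate.\<close>
    have d_sum: "summable (\<lambda>k. norm (d k))"
    proof (rule KL_finite_length)
      show "KL_property_at ?H (xs, 0)" by (rule KL_H)
      show "(\<lambda>k. ?H (z k)) \<longlonglongrightarrow> ?H (xs, 0)" using h_lim by (simp add: z_def h_def l)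
      show "?H (xs, 0) < ?H (z k)" for k using h_gt[of k] by (simp add: z_def h_def l)
      show "strict_mono r" by (rule r)
      have "(\<lambda>k. ((x \<circ> r) k, (t \<circ> r) k)) \<longlonglongrightarrow> (xs, 0)"
        using r(2) LIMSEQ_subseq_LIMSEQ[OF t_lim r(1)] by (rule tendsto_Pair)
      then show "(z \<circ> r) \<longlonglongrightarrow> (xs, 0)" by (simp add: z_def o_def)
      show "0 < c / 2" using c by simp
      show "0 < \<eta> * L + 1" using \<open>0 < \<eta>\<close> \<open>L > 0\<close> by (simp add: add_pos_pos)
      show "summable (\<lambda>k. \<epsilon> k + (t k + t (Suc k)))"
        using t_sum \<epsilon>_sum by (intro summable_add) (auto simp: summable_Suc_iff)
      show "0 \<le> \<epsilon> k + (t k + t (Suc k))" for k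
        using \<epsilon>0[of k] t_pos[of k] t_pos[of "Suc k"] by simp
      show "?H (z (Suc k)) + c / 2 * (norm (d k))\<^sup>2 \<le> ?H (z k)" for k
        using h_less[of k] by (simp add: z_def h_def)
      show "norm (gradient ?H (z (Suc k))) \<le> (\<eta> * L + 1) * norm (d k) + (\<epsilon> k + (t k + t (Suc k)))" for k
        using norm_Pair_le[of "gradient F (x (Suc k))" "t (Suc k)"] grad_le[of k]
          t_pos[of k] t_pos[of "Suc k"]
        unfolding z_def grad_H by simp
      show "norm (z (Suc k) - z k) \<le> norm (d k) + (\<epsilon> k + (t k + t (Suc k)))" for k
        using norm_Pair_le[of "d k" "t (Suc k) - t k"] \<epsilon>0[of k] t_pos[of k] t_pos[of "Suc k"]
        by (simp add: z_def d_def)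
    qed simp
    have "summable d" using d_sum by (rule summable_norm_cancel)
    then have "(\<lambda>n. \<Sum>k<n. d k) \<longlonglongrightarrow> suminf d" by (rule summable_LIMSEQ)
    then have "(\<lambda>n. x 0 + (\<Sum>k<n. d k)) \<longlonglongrightarrow> x 0 + suminf d" by (intro tendsto_intros)
    moreover have "x 0 + (\<Sum>k<n. d k) = x n" for n
      by (simp add: d_def sum_lessThan_telescope)
    ultimately have x_lim: "x \<longlonglongrightarrow> x 0 + suminf d" by simp
    define y where "y = x 0 + suminf d"
    have "(\<lambda>k. (\<eta> * L + 1) * norm (d k) + \<epsilon> k) \<longlonglongrightarrow> (\<eta> * L + 1) * 0 + 0"
      by (intro tendsto_add tendsto_mult_left summable_LIMSEQ_zero d_sum \<epsilon>_sum)
    then have "(\<lambda>k. (\<eta> * L + 1) * norm (d k) + \<epsilon> k) \<longlonglongrightarrow> 0"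
      by simp
    then have "(\<lambda>k. gradient F (x (Suc k))) \<longlonglongrightarrow> 0"
      by (rule Lim_null_comparison[rotated]) (use grad_le in \<open>auto intro!: always_eventually\<close>)
    moreover have "(\<lambda>k. gradient F (x (Suc k))) \<longlonglongrightarrow> gradient F y"
      using F_cont LIMSEQ_Suc[OF x_lim] unfolding y_def by (rule isCont_tendsto_compose)
    ultimately have "gradient F y = 0" by (rule LIMSEQ_unique[symmetric])
    then have "critical_point F y" using grad_F[of y] by (simp add: critical_point_def)
    moreover have "summable (\<lambda>k. norm (d (Suc k)))" using d_sum summable_Suc_iff[of "\<lambda>k. norm (d k)"] by blast
    ultimately show ?thesis using x_lim unfolding y_def shift by blast
  qed
  moreover have "convergent (\<lambda>k. F (x k))" using F_lim by (rule convergentI)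
  moreover have "summable (\<lambda>k. (norm (x (k + 1) - x (k + 2)))\<^sup>2)"
    unfolding shift using d_sq summable_Suc_iff[of "\<lambda>k. (norm (d k))\<^sup>2"] by blast
  ultimately show ?thesis by blast
qed

end
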